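(* Fix a level $c$ of $C$. Assume that for all $a,a^*\in\{0,1\}$ and all $m$, $$Y_{am}\perp A\mid (C,U),\quad Y_{am}\perp M\mid (A,C,U),\quad M_a\perp A\mid (C,U),\quad Y_{am}\perp M_{a^*}\mid (C,U),$$ and that $A\perp U\mid C$. Then the true conditional natural indirect effect on the risk ratio scale satisfies $$\mathrm{NIE}^{\mathrm{true}}_{\mathrm{RR}|c}\;\le\;\mathrm{NIE}^{\mathrm{obs}}_{\mathrm{RR}|c}\times\mathrm{BF}_{U|(M,c)},$$ and this bound is sharp, i.e. attainable: for all finite $\gamma,\delta\ge 1$ there is a joint distribution satisfying all the assumptions, with $\mathrm{RR}_{AU|(M,c)}=\gamma$ and $\mathrm{RR}_{UY|(A=1,M,c)}=\delta$, for which equality holds.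
   Context: Setting. $A\in\{0,1\}$ is a binary exposure, $Y\in\{0,1\}$ a binary outcome, $M$ a categorical mediator, $C$ categorical observed baseline covariates and $U$ categorical unmeasured baseline covariates ($M$, $C$, $U$ take finitely many values; they may be vectors). $Y_a$ and $M_a$ are the potential outcome and potential mediator under exposure $a$; $Y_{am}$ is the potential outcome under exposure $a$ and mediator value $m$; $Y_{aM_{a^*}}$ is the potential outcome under exposure $a$ with the mediator set to $M_{a^*}$. Consistency: $Y_a=Y$ and $M_a=M$ if $A=a$; $Y_{am}=Y$ if $A=a$ and $M=m$. Composition: $Y_{aM_a}=Y_a$ for $a=0,1$. The symbol $\perp$ denotes (conditional) independence; lower-case $m,c,u$ in conditional probabilities stand for the events $M=m$, $C=c$, $U=u$. Effects. $\mathrm{NIE}^{\mathrm{true}}_{\mathrm{RR}|c}=\dfrac{P(Y_{1M_1}=1\mid c)}{P(Y_{1M_0}=1\mid c)}$ and $\mathrm{NIE}^{\mathrm{obs}}_{\mathrm{RR}|c}=\dfrac{\sum_m P(Y=1\mid A=1,m,c)P(m\mid A=1,c)}{\sum_m P(Y=1\mid A=1,m,c)P(m\mid A=0,c)}$. Sensitivity parameters. $$\mathrm{RR}_{UY|(A=1,M,c)}=\max_m\frac{\max_u P(Y=1\mid A=1,m,c,u)}{\min_u P(Y=1\mid A=1,m,c,u)},\qquad \mathrm{RR}_{AU|(M,c)}=\max_m\max_u\frac{P(u\mid A=1,m,c)}{P(u\mid A=0,m,c)}.$$ Bounding factor: $$\mathrm{BF}_{U|(M,c)}=\frac{\mathrm{RR}_{AU|(M,c)}\times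 \mathrm{RR}_{UY|(A=1,M,c)}}{\mathrm{RR}_{AU|(M,c)}+\mathrm{RR}_{UY|(A=1,M,c)}-1}.$$ Conventions. $P(C=c)>0$, $P(A=a\mid c)>0$ for $a=0,1$, and $P(m\mid A=1,c)>0$ whenever $P(m\mid A=0,c)>0$; denominators in the effects are positive, and $P(Y=1\mid A=0,c)>0$. Maxima over $m$ are over $m$ with $P(m\mid A=0,c)>0$; $u$ ranges over values with $P(u\mid c)>0$. $P(Y=1\mid A=a,m,c,u)$ is understood as $P(Y_{am}=1\mid c,u)$ (with which it coincides under the independence assumptions) when its conditioning event has probability zero. A positive number over $0$ is $+\infty$; ratios $0/0$ are omitted from the maximum defining $\mathrm{RR}_{AU|(M,c)}$ and are read as $1$ in $\mathrm{RR}_{UY|(A=1,M,c)}$. If exactly one sensitivity parameter is infinite, $\mathrm{BF}_{U|(M,c)}$ equals the other; if both are, $\mathrm{BF}_{U|(M,c)}=\infty$ and the bound is vacuous. *)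

theory Defs
  imports "HOL-Probability.Probability"
begin

text \<open>
  A joint distribution of exposure, outcome, mediator, covariates and potential outcomes is given
  by random variables on a common sample space. Binary variables are Boolean-valued, with
  \<^term>\<open>True\<close> for 1 and \<^term>\<open>False\<close> for 0; categorical variables take values in finite types.
\<close>

record ('w, 'm, 'c, 'u) mediation_data =
  law :: "'w measure"
  exposure :: "'w \<Rightarrow> bool"                       \<comment> \<open>\<open>A\<close>\<close>
  outcome :: "'w \<Rightarrow> bool"                        \<comment> \<open>\<open>Y\<close>\<close>
  mediator :: "'w \<Rightarrow> 'm"                         \<comment> \<open>\<open>M\<close>\<close>
  covariate :: "'w \<Rightarrow> 'c"                        \<comment> \<open>\<open>C\<close>\<close>
  confounder :: "'w \<Rightarrow> 'u"                       \<comment> \<open>\<open>U\<close>, unmeasured\<close>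
  outcome_a :: "bool \<Rightarrow> 'w \<Rightarrow> bool"              \<comment> \<open>\<open>Y\<^sub>a\<close>\<close>
  mediator_a :: "bool \<Rightarrow> 'w \<Rightarrow> 'm"               \<comment> \<open>\<open>M\<^sub>a\<close>\<close>
  outcome_am :: "bool \<Rightarrow> 'm \<Rightarrow> 'w \<Rightarrow> bool"       \<comment> \<open>\<open>Y\<^sub>a\<^sub>m\<close>\<close>

text \<open>The potential outcome under exposure \<open>a\<close> with the mediator set to \<open>M\<^sub>b\<close>.\<close>

definition nested_outcome ::
  "('w, 'm, 'c, 'u) mediation_data \<Rightarrow> bool \<Rightarrow> bool \<Rightarrow> 'w \<Rightarrow> bool" where
  "nested_outcome D a b \<omega> = outcome_am D a (mediator_a D b \<omega>) \<omega>"

text \<open>Conditional independence of \<open>X\<close> and \<open>Y\<close> given \<open>Z\<close>, for variables with finitely many values.\<close>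

definition cond_indep ::
  "'w measure \<Rightarrow> ('w \<Rightarrow> 'x) \<Rightarrow> ('w \<Rightarrow> 'y) \<Rightarrow> ('w \<Rightarrow> 'z) \<Rightarrow> bool" where
  "cond_indep P X Y Z \<longleftrightarrow>
     (\<forall>x y z. \<P>(\<omega> in P. Z \<omega> = z) > 0 \<longrightarrow>
        \<P>(\<omega> in P. X \<omega> = x \<and> Y \<omega> = y \<bar> Z \<omega> = z) =
        \<P>(\<omega> in P. X \<omega> = x \<bar> Z \<omega> = z) * \<P>(\<omega> in P. Y \<omega> = y \<bar> Z \<omega> = z))"

definition random_variables :: "('w, 'm::finite, 'c::finite, 'u::finite) mediation_data \<Rightarrow> bool" where
  "random_variables D \<longleftrightarrow>
     exposure D \<in> law D \<rightarrow>\<^sub>M count_space UNIV \<and>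
     outcome D \<in> law D \<rightarrow>\<^sub>M count_space UNIV \<and>
     mediator D \<in> law D \<rightarrow>\<^sub>M count_space UNIV \<and>
     covariate D \<in> law D \<rightarrow>\<^sub>M count_space UNIV \<and>
     confounder D \<in> law D \<rightarrow>\<^sub>M count_space UNIV \<and>
     (\<forall>a. outcome_a D a \<in> law D \<rightarrow>\<^sub>M count_space UNIV) \<and>
     (\<forall>a. mediator_a D a \<in> law D \<rightarrow>\<^sub>M count_space UNIV) \<and>
     (\<forall>a m. outcome_am D a m \<in> law D \<rightarrow>\<^sub>M count_space UNIV)"

definition consistency :: "('w, 'm, 'c, 'u) mediation_data \<Rightarrow> bool" where
  "consistency D \<longleftrightarrow>
     (\<forall>\<omega>\<in>space (law D). \<forall>a. exposure D \<omega> = a \<longrightarrow>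
        outcome_a D a \<omega> = outcome D \<omega> \<and> mediator_a D a \<omega> = mediator D \<omega>) \<and>
     (\<forall>\<omega>\<in>space (law D). \<forall>a m. exposure D \<omega> = a \<and> mediator D \<omega> = m \<longrightarrow>
        outcome_am D a m \<omega> = outcome D \<omega>)"

definition composition :: "('w, 'm, 'c, 'u) mediation_data \<Rightarrow> bool" where
  "composition D \<longleftrightarrow> (\<forall>\<omega>\<in>space (law D). \<forall>a. nested_outcome D a a \<omega> = outcome_a D a \<omega>)"

definition mediation_model :: "('w, 'm::finite, 'c::finite, 'u::finite) mediation_data \<Rightarrow> bool" where
  "mediation_model D \<longleftrightarrow>
     prob_space (law D) \<and> random_variables D \<and> consistency D \<and> composition D"

definition no_confounding_given_CU :: "('w, 'm, 'c, 'u) mediation_data \<Rightarrow> bool" where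
  "no_confounding_given_CU D \<longleftrightarrow>
     (\<forall>a b m.
        cond_indep (law D) (outcome_am D a m) (exposure D) (\<lambda>\<omega>. (covariate D \<omega>, confounder D \<omega>)) \<and>
        cond_indep (law D) (outcome_am D a m) (mediator D)
          (\<lambda>\<omega>. (exposure D \<omega>, covariate D \<omega>, confounder D \<omega>)) \<and>
        cond_indep (law D) (mediator_a D a) (exposure D) (\<lambda>\<omega>. (covariate D \<omega>, confounder D \<omega>)) \<and>
        cond_indep (law D) (outcome_am D a m) (mediator_a D b)
          (\<lambda>\<omega>. (covariate D \<omega>, confounder D \<omega>)))"

definition NIE_true :: "('w, 'm, 'c, 'u) mediation_data \<Rightarrow> 'c \<Rightarrow> real" where
  "NIE_true D c =
     \<P>(\<omega> in law D. nested_outcome D True True \<omega> \<bar> covariate D \<omega> = c) /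
     \<P>(\<omega> in law D. nested_outcome D True False \<omega> \<bar> covariate D \<omega> = c)"

definition standardized_risk ::
  "('w, 'm::finite, 'c, 'u) mediation_data \<Rightarrow> bool \<Rightarrow> 'c \<Rightarrow> real" where
  "standardized_risk D a c =
     (\<Sum>m\<in>UNIV.
        \<P>(\<omega> in law D. outcome D \<omega> \<bar> exposure D \<omega> \<and> mediator D \<omega> = m \<and> covariate D \<omega> = c) *
        \<P>(\<omega> in law D. mediator D \<omega> = m \<bar> exposure D \<omega> = a \<and> covariate D \<omega> = c))"

definition NIE_obs :: "('w, 'm::finite, 'c, 'u) mediation_data \<Rightarrow> 'c \<Rightarrow> real" where
  "NIE_obs D c = standardized_risk D True c / standardized_risk D False c"

definition positivity :: "('w, 'm::finite, 'c, 'u) mediation_data \<Rightarrow> 'c \<Rightarrow> bool" where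
  "positivity D c \<longleftrightarrow>
     \<P>(\<omega> in law D. covariate D \<omega> = c) > 0 \<and>
     (\<forall>a. \<P>(\<omega> in law D. exposure D \<omega> = a \<bar> covariate D \<omega> = c) > 0) \<and>
     (\<forall>m. \<P>(\<omega> in law D. mediator D \<omega> = m \<bar> \<not> exposure D \<omega> \<and> covariate D \<omega> = c) > 0 \<longrightarrow>
          \<P>(\<omega> in law D. mediator D \<omega> = m \<bar> exposure D \<omega> \<and> covariate D \<omega> = c) > 0) \<and>
     \<P>(\<omega> in law D. nested_outcome D True False \<omega> \<bar> covariate D \<omega> = c) > 0 \<and>
     standardized_risk D False c > 0 \<and>
     \<P>(\<omega> in law D. outcome D \<omega> \<bar> \<not> exposure D \<omega> \<and> covariate D \<omega> = c) > 0"

text \<open>The values of \<open>m\<close> and \<open>u\<close> over which the maxima and minima below are taken.\<close>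

definition mediator_levels :: "('w, 'm, 'c, 'u) mediation_data \<Rightarrow> 'c \<Rightarrow> 'm set" where
  "mediator_levels D c =
     {m. \<P>(\<omega> in law D. mediator D \<omega> = m \<bar> \<not> exposure D \<omega> \<and> covariate D \<omega> = c) > 0}"

definition confounder_levels :: "('w, 'm, 'c, 'u) mediation_data \<Rightarrow> 'c \<Rightarrow> 'u set" where
  "confounder_levels D c = {u. \<P>(\<omega> in law D. confounder D \<omega> = u \<bar> covariate D \<omega> = c) > 0}"

text \<open>
  \<open>P(Y=1 | A=1,m,c,u)\<close>, read as \<open>P(Y\<^sub>1\<^sub>m=1 | c,u)\<close> when the conditioning event is null.
\<close>

definition outcome_risk :: "('w, 'm, 'c, 'u) mediation_data \<Rightarrow> 'm \<Rightarrow> 'c \<Rightarrow> 'u \<Rightarrow> real" where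
  "outcome_risk D m c u =
     (if \<P>(\<omega> in law D. exposure D \<omega> \<and> mediator D \<omega> = m \<and> covariate D \<omega> = c \<and> confounder D \<omega> = u) > 0
      then \<P>(\<omega> in law D. outcome D \<omega> \<bar>
             exposure D \<omega> \<and> mediator D \<omega> = m \<and> covariate D \<omega> = c \<and> confounder D \<omega> = u)
      else \<P>(\<omega> in law D. outcome_am D True m \<omega> \<bar> covariate D \<omega> = c \<and> confounder D \<omega> = u))"

definition confounder_prob ::
  "('w, 'm, 'c, 'u) mediation_data \<Rightarrow> bool \<Rightarrow> 'm \<Rightarrow> 'c \<Rightarrow> 'u \<Rightarrow> real" where
  "confounder_prob D a m c u =
     \<P>(\<omega> in law D. confounder D \<omega> = u \<bar> exposure D \<omega> = a \<and> mediator D \<omega> = m \<and> covariate D \<omega> = c)"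

text \<open>
  The sensitivity parameters are extended reals: \<^typ>\<open>ereal\<close> division of a positive number
  by \<open>0\<close> is \<open>\<infinity>\<close>, but \<open>0 / 0 = 0\<close>, so that case is treated separately.
\<close>

definition RR_UY :: "('w, 'm, 'c, 'u) mediation_data \<Rightarrow> 'c \<Rightarrow> ereal" where
  "RR_UY D c =
     Max ((\<lambda>m.
       let hi = Max (outcome_risk D m c ` confounder_levels D c);
           lo = Min (outcome_risk D m c ` confounder_levels D c)
       in if hi = 0 \<and> lo = 0 then 1 else ereal hi / ereal lo) ` mediator_levels D c)"

definition RR_AU :: "('w, 'm, 'c, 'u) mediation_data \<Rightarrow> 'c \<Rightarrow> ereal" where
  "RR_AU D c =
     Max ((\<lambda>m.
       Max ((\<lambda>u. ereal (confounder_prob D True m c u) / ereal (confounder_prob D False m c u)) `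
         {u \<in> confounder_levels D c.
            \<not> (confounder_prob D True m c u = 0 \<and> confounder_prob D False m c u = 0)})) `
       mediator_levels D c)"

text \<open>
  An infinite argument is replaced by the limit of the formula. The product of an observed effect with
  an infinite factor is \<open>\<infinity>\<close>, except that \<open>0 * \<infinity> = 0\<close> in \<^typ>\<open>ereal\<close>; in that
  case the true effect is \<open>0\<close> as well.
\<close>

definition bounding_factor :: "ereal \<Rightarrow> ereal \<Rightarrow> ereal" where
  "bounding_factor r s =
     (if r = \<infinity> then s else if s = \<infinity> then r else r * s / (r + s - 1))"

definition BF :: "('w, 'm, 'c, 'u) mediation_data \<Rightarrow> 'c \<Rightarrow> ereal" where
  "BF D c = bounding_factor (RR_AU D c) (RR_UY D c)"

definition mediation_assumptions ::
  "('w, 'm::finite, 'c::finite, 'u::finite) mediation_data \<Rightarrow> 'c \<Rightarrow> bool" where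
  "mediation_assumptions D c \<longleftrightarrow>
     mediation_model D \<and> positivity D c \<and> no_confounding_given_CU D \<and>
     cond_indep (law D) (exposure D) (confounder D) (covariate D)"

end

theory Submission
  imports Defs
begin

text \<open>
  Everything is conditional on \<open>C = c\<close>. Write \<open>r m u = P(Y\<^sub>1\<^sub>m=1 | c,u)\<close>. Given \<open>(c,u)\<close>, the
  variables \<open>Y\<^sub>1\<^sub>m\<close> and \<open>M\<^sub>b\<close> are independent of each other and of the exposure actually
  received. Hence the probability of the nested outcome is an average of strata means,
  \<open>P(Y\<^sub>1\<^sub>M\<^sub>b=1 | c) = (\<Sum>m. P(m | A=b,c) * (\<Sum>u. r m u * P(u | A=b,m,c)))\<close>, where \<open>A \<bottom> U | C\<close> turns
  the weights \<open>P(u | c) * P(M\<^sub>b=m | c,u)\<close> into \<open>P(m | A=b,c) * P(u | A=b,m,c)\<close>. The observed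
  standardization always uses the confounder law of the exposed, \<open>P(u | A=1,m,c)\<close>. So the
  numerators of the true and of the observed effect agree, and the denominators differ only in
  the law that is used to average \<open>r m\<close> in each stratum \<open>m\<close>.

  This reduces the bound to a statement about two laws \<open>f1, f0\<close> on a finite set with
  \<open>f1 \<le> g * f0\<close> and a function whose values vary by a factor at most \<open>d\<close>: its means differ by a
  factor at most \<open>g * d / (g + d - 1)\<close> (\<open>weighted_mean_le_bounding_factor\<close>, extended to infinite
  parameters in \<open>mean_le_bounding_factor\<close>). Averaging over \<open>m\<close> with the weights \<open>P(m | A=0,c)\<close>
  gives the theorem.

  The inequality for means is an equality when the function takes only the values \<open>lo\<close> and
  \<open>d * lo\<close> and \<open>f1\<close> sits where it is \<open>d * lo\<close>, with \<open>f1 = g * f0\<close> there. For \<open>g > 1\<close>, a binary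
  \<open>U\<close> with \<open>P(U=1) = 1/g\<close>, a mediator that is constant without exposure and equal to \<open>U\<close> with
  exposure, and an outcome risk of \<open>1\<close> or \<open>1/d\<close> according to \<open>U\<close> realise this (\<open>bound_attained\<close>).
\<close>

section \<open>The bounding factor for a ratio of means\<close>

text \<open>
  Subtract the lower bound \<open>lo\<close> from \<open>r\<close> and let \<open>x\<close> and \<open>y\<close> be the means of the remainder under
  \<open>f1\<close> and \<open>f0\<close>. Then \<open>y \<ge> x / g\<close> and \<open>x \<le> (d - 1) * lo\<close>, while \<open>(lo + x) / (lo + x / g)\<close>
  increases with \<open>x\<close>; its value at the largest \<open>x\<close> is the bounding factor.
\<close>

lemma weighted_mean_le_bounding_factor:
  fixes f0 f1 r :: "'a \<Rightarrow> real"
  assumes f1: "sum f1 S = 1" "\<And>u. u \<in> S \<Longrightarrow> 0 \<le> f1 u"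
    and f0: "sum f0 S = 1" "\<And>u. u \<in> S \<Longrightarrow> f1 u \<le> g * f0 u"
    and r: "\<And>u. u \<in> S \<Longrightarrow> lo \<le> r u" "\<And>u. u \<in> S \<Longrightarrow> r u \<le> hi"
    and hi: "hi \<le> d * lo" and g: "1 \<le> g" and d: "1 \<le> d"
  shows "(\<Sum>u\<in>S. r u * f1 u) \<le> g * d / (g + d - 1) * (\<Sum>u\<in>S. r u * f0 u)"
proof -
  define x where "x = (\<Sum>u\<in>S. (r u - lo) * f1 u)"
  define y where "y = (\<Sum>u\<in>S. (r u - lo) * f0 u)"
  have mean1: "(\<Sum>u\<in>S. r u * f1 u) = lo + x"
    using f1(1) by (simp add: x_def left_diff_distrib sum_subtractf flip: sum_distrib_left)
  have mean0: "(\<Sum>u\<in>S. r u * f0 u) = lo + y"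
    using f0(1) by (simp add: y_def left_diff_distrib sum_subtractf flip: sum_distrib_left)
  have "x \<le> (\<Sum>u\<in>S. (r u - lo) * (g * f0 u))"
    unfolding x_def using f0(2) r(1) by (intro sum_mono mult_left_mono) auto
  also have "\<dots> = g * y"
    by (simp add: y_def sum_distrib_left mult_ac)
  finally have x_le_y: "x \<le> g * y" .
  have "x \<le> (\<Sum>u\<in>S. (hi - lo) * f1 u)"
    unfolding x_def using f1(2) r(2) by (intro sum_mono mult_right_mono) auto
  also have "\<dots> = hi - lo"
    using f1(1) by (simp flip: sum_distrib_left)
  finally have x_le: "x \<le> (d - 1) * lo"
    using hi by (simp add: algebra_simps)
  have "(g - 1) * x \<le> (g - 1) * ((d - 1) * lo)"
    using g x_le by (intro mult_left_mono) auto
  moreover have "d * x \<le> d * (g * y)"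
    using d x_le_y by (intro mult_left_mono) auto
  \<comment> \<open>The difference of the two sides below is the sum of the slacks in the two preceding facts.\<close>
  ultimately have "(lo + x) * (g + d - 1) \<le> g * d * (lo + y)"
    by (simp add: algebra_simps)
  then show ?thesis
    unfolding mean1 mean0 using g d by (simp add: field_simps)
qed

lemma bounding_factor_cases:
  fixes R T :: ereal
  assumes "1 \<le> R" "1 \<le> T"
  obtains (vacuous) "R = \<infinity>" "T = \<infinity>"
    | (left_infinite) d where "R = \<infinity>" "T = ereal d" "bounding_factor R T = ereal d" "1 \<le> d"
    | (right_infinite) g where "R = ereal g" "T = \<infinity>" "bounding_factor R T = ereal g" "1 \<le> g"
    | (finite) g d where "R = ereal g" "T = ereal d" "1 \<le> g" "1 \<le> d"
        "bounding_factor R T = ereal (g * d / (g + d - 1))"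
  using assms by (cases R; cases T) (auto simp: bounding_factor_def one_ereal_def)

text \<open>
  With one parameter infinite, a single comparison remains, and it gives the other parameter as
  the factor: the mean under \<open>f1\<close> is at most \<open>hi\<close> and the mean under \<open>f0\<close> at least \<open>lo\<close>, or
  \<open>f1 \<le> g * f0\<close> is used pointwise.
\<close>

lemma mean_le_bounding_factor:
  fixes f0 f1 r :: "'a \<Rightarrow> real" and R T :: ereal
  assumes f1: "sum f1 S = 1" "\<And>u. u \<in> S \<Longrightarrow> 0 \<le> f1 u"
    and f0: "sum f0 S = 1" "\<And>u. u \<in> S \<Longrightarrow> 0 \<le> f0 u"
    and r: "\<And>u. u \<in> S \<Longrightarrow> 0 \<le> r u" "\<And>u. u \<in> S \<Longrightarrow> lo \<le> r u" "\<And>u. u \<in> S \<Longrightarrow> r u \<le> hi"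
    and R: "1 \<le> R" "\<And>g u. R = ereal g \<Longrightarrow> u \<in> S \<Longrightarrow> f1 u \<le> g * f0 u"
    and T: "1 \<le> T" "\<And>d. T = ereal d \<Longrightarrow> hi \<le> d * lo"
    and b: "bounding_factor R T = ereal b"
  shows "(\<Sum>u\<in>S. r u * f1 u) \<le> b * (\<Sum>u\<in>S. r u * f0 u)"
  using R(1) T(1)
proof (cases rule: bounding_factor_cases)
  case vacuous
  then show ?thesis using b by (simp add: bounding_factor_def)
next
  case (left_infinite d)
  have "(\<Sum>u\<in>S. r u * f1 u) \<le> (\<Sum>u\<in>S. hi * f1 u)"
    using r(3) f1(2) by (intro sum_mono mult_right_mono) auto
  also have "\<dots> \<le> d * lo"
    using f1(1) T(2)[OF left_infinite(2)] by (simp flip: sum_distrib_left)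
  also have "\<dots> = d * (\<Sum>u\<in>S. lo * f0 u)"
    using f0(1) by (simp flip: sum_distrib_left)
  also have "\<dots> \<le> d * (\<Sum>u\<in>S. r u * f0 u)"
    using left_infinite(4) r(2) f0(2) by (intro mult_left_mono sum_mono mult_right_mono) auto
  finally show ?thesis using b left_infinite by simp
next
  case (right_infinite g)
  have "(\<Sum>u\<in>S. r u * f1 u) \<le> (\<Sum>u\<in>S. r u * (g * f0 u))"
    using r(1) R(2)[OF right_infinite(1)] by (intro sum_mono mult_left_mono) auto
  also have "\<dots> = g * (\<Sum>u\<in>S. r u * f0 u)"
    by (simp add: sum_distrib_left mult_ac)
  finally show ?thesis using b right_infinite by simp
next
  case (finite g d)
  then have "b = g * d / (g + d - 1)" using b by simp
  then show ?thesis
    using weighted_mean_le_bounding_factor[of f1 S f0 g lo r hi d,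
        OF f1 f0(1) R(2)[OF finite(1)] r(2,3) T(2)[OF finite(2)] finite(3,4)]
    by blast
qed

section \<open>Identification of the effects\<close>

text \<open>
  The definition of conditional independence only speaks of levels of \<open>Z\<close> with positive
  probability. In this product form null levels need no exception, because both sides vanish
  there.
\<close>

lemma (in prob_space) cond_indep_prob:
  assumes indep: "cond_indep M X Y Z"
    and [measurable]: "X \<in> M \<rightarrow>\<^sub>M count_space UNIV" "Y \<in> M \<rightarrow>\<^sub>M count_space UNIV"
      "Z \<in> M \<rightarrow>\<^sub>M count_space UNIV"
  shows "\<P>(\<omega> in M. X \<omega> = x \<and> Y \<omega> = y \<and> Z \<omega> = z) =
    \<P>(\<omega> in M. X \<omega> = x \<bar> Z \<omega> = z) * \<P>(\<omega> in M. Y \<omega> = y \<and> Z \<omega> = z)"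
proof (cases "\<P>(\<omega> in M. Z \<omega> = z) = 0")
  case True
  have "\<P>(\<omega> in M. X \<omega> = x \<and> Y \<omega> = y \<and> Z \<omega> = z) \<le> \<P>(\<omega> in M. Z \<omega> = z)"
    "\<P>(\<omega> in M. Y \<omega> = y \<and> Z \<omega> = z) \<le> \<P>(\<omega> in M. Z \<omega> = z)"
    by (intro finite_measure_mono; auto)+
  then show ?thesis using True by (simp add: measure_le_0_iff)
next
  case False
  then have pos: "\<P>(\<omega> in M. Z \<omega> = z) > 0" by (simp add: zero_less_measure_iff)
  with indep have "\<P>(\<omega> in M. X \<omega> = x \<and> Y \<omega> = y \<bar> Z \<omega> = z) =
        \<P>(\<omega> in M. X \<omega> = x \<bar> Z \<omega> = z) * \<P>(\<omega> in M. Y \<omega> = y \<bar> Z \<omega> = z)"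
    unfolding cond_indep_def by blast
  then show ?thesis using pos by (simp add: cond_prob_def field_simps)
qed

lemma (in prob_space) prob_total:
  fixes X :: "'a \<Rightarrow> 'x::finite"
  assumes [measurable]: "X \<in> M \<rightarrow>\<^sub>M count_space UNIV" "Measurable.pred M Q"
  shows "\<P>(\<omega> in M. Q \<omega>) = (\<Sum>x\<in>UNIV. \<P>(\<omega> in M. Q \<omega> \<and> X \<omega> = x))"
  by (rule prob_sum) auto

locale mediation =
  fixes D :: "('w, 'm::finite, 'c::finite, 'u::finite) mediation_data" and c :: 'c
  assumes assumptions: "mediation_assumptions D c"
begin

sublocale prob_space "law D"
  using assumptions by (simp add: mediation_assumptions_def mediation_model_def)

abbreviation A where "A \<equiv> exposure D"
abbreviation Y where "Y \<equiv> outcome D"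
abbreviation M where "M \<equiv> mediator D"
abbreviation C where "C \<equiv> covariate D"
abbreviation U where "U \<equiv> confounder D"
abbreviation pr where "pr Q \<equiv> \<P>(\<omega> in law D. Q \<omega>)"

lemma measurable_variables [measurable]:
  "A \<in> law D \<rightarrow>\<^sub>M count_space UNIV" "Y \<in> law D \<rightarrow>\<^sub>M count_space UNIV"
  "M \<in> law D \<rightarrow>\<^sub>M count_space UNIV" "C \<in> law D \<rightarrow>\<^sub>M count_space UNIV"
  "U \<in> law D \<rightarrow>\<^sub>M count_space UNIV" "mediator_a D a \<in> law D \<rightarrow>\<^sub>M count_space UNIV"
  "outcome_am D a m \<in> law D \<rightarrow>\<^sub>M count_space UNIV"
  using assumptions
  by (simp_all add: mediation_assumptions_def mediation_model_def random_variables_def)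

text \<open>
  The four independence assumptions and \<open>A \<bottom> U | C\<close> factorize all joint probabilities below into
  these four functions. A mediator probability \<open>q b m u\<close> or a risk \<open>r m u\<close> at a null level \<open>u\<close> is
  \<open>0\<close> by the convention for division; it only ever occurs multiplied by \<open>w u = 0\<close>.
\<close>

definition e where "e a = \<P>(\<omega> in law D. A \<omega> = a \<bar> C \<omega> = c)"
definition w where "w u = pr (\<lambda>\<omega>. C \<omega> = c \<and> U \<omega> = u)"
definition q where "q b m u = \<P>(\<omega> in law D. mediator_a D b \<omega> = m \<bar> C \<omega> = c \<and> U \<omega> = u)"
definition r where "r m u = \<P>(\<omega> in law D. outcome_am D True m \<omega> \<bar> C \<omega> = c \<and> U \<omega> = u)"

lemma e_pos: "e a > 0"
  using assumptions by (simp add: mediation_assumptions_def positivity_def e_def)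

lemma w_nonneg: "w u \<ge> 0" and q_nonneg: "q b m u \<ge> 0" and r_nonneg: "r m u \<ge> 0"
  by (simp_all add: w_def q_def r_def cond_prob_def)

lemma consistent:
  assumes "\<omega> \<in> space (law D)" "A \<omega> = a"
  shows "mediator_a D a \<omega> = M \<omega>" "M \<omega> = m \<Longrightarrow> outcome_am D a m \<omega> = Y \<omega>"
  using assumptions assms
  by (auto simp: mediation_assumptions_def mediation_model_def consistency_def)

lemma prob_A_C_U: "pr (\<lambda>\<omega>. A \<omega> = a \<and> C \<omega> = c \<and> U \<omega> = u) = e a * w u"
proof -
  have "cond_indep (law D) A U C"
    using assumptions by (simp add: mediation_assumptions_def)
  from cond_indep_prob[OF this, of a u c] show ?thesis
    by (simp add: e_def w_def conj_commute)
qed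

lemma prob_mediator_a:
  "pr (\<lambda>\<omega>. mediator_a D b \<omega> = m \<and> C \<omega> = c \<and> U \<omega> = u) = q b m u * w u"
proof (cases "w u = 0")
  case True
  have "pr (\<lambda>\<omega>. mediator_a D b \<omega> = m \<and> C \<omega> = c \<and> U \<omega> = u) \<le> w u"
    unfolding w_def by (intro finite_measure_mono) auto
  then show ?thesis using True by (simp add: measure_le_0_iff)
qed (simp add: q_def w_def cond_prob_def)

lemma independences:
  "cond_indep (law D) (outcome_am D a m) A (\<lambda>\<omega>. (C \<omega>, U \<omega>))"
  "cond_indep (law D) (outcome_am D a m) M (\<lambda>\<omega>. (A \<omega>, C \<omega>, U \<omega>))"
  "cond_indep (law D) (mediator_a D a) A (\<lambda>\<omega>. (C \<omega>, U \<omega>))"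
  "cond_indep (law D) (outcome_am D a m) (mediator_a D b) (\<lambda>\<omega>. (C \<omega>, U \<omega>))"
  using assumptions by (auto simp: mediation_assumptions_def no_confounding_given_CU_def)

text \<open>
  Consistency replaces \<open>M\<close> by \<open>M\<^sub>a\<close> on \<open>A = a\<close>, after which \<open>M\<^sub>a\<close> can be separated from \<open>A\<close>.
\<close>

lemma prob_M_A_C_U:
  "pr (\<lambda>\<omega>. M \<omega> = m \<and> A \<omega> = a \<and> C \<omega> = c \<and> U \<omega> = u) = e a * (q a m u * w u)"
proof -
  have "pr (\<lambda>\<omega>. M \<omega> = m \<and> A \<omega> = a \<and> C \<omega> = c \<and> U \<omega> = u) =
      pr (\<lambda>\<omega>. mediator_a D a \<omega> = m \<and> A \<omega> = a \<and> C \<omega> = c \<and> U \<omega> = u)"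
    using consistent(1) by (intro arg_cong[where f = "measure (law D)"]) auto
  also have "\<dots> = q a m u * (e a * w u)"
    using cond_indep_prob[OF independences(3), of a m a "(c, u)"]
    by (simp add: q_def prob_A_C_U)
  finally show ?thesis by simp
qed

lemma prob_outcome_am_mediator_a:
  "pr (\<lambda>\<omega>. outcome_am D True m \<omega> \<and> mediator_a D b \<omega> = m \<and> C \<omega> = c \<and> U \<omega> = u) =
    r m u * (q b m u * w u)"
  using cond_indep_prob[OF independences(4), of True m b True m "(c, u)"]
  by (simp add: r_def prob_mediator_a)

lemma cond_prob_outcome_am:
  assumes "w u > 0"
  shows "\<P>(\<omega> in law D. outcome_am D True m \<omega> \<bar> A \<omega> \<and> C \<omega> = c \<and> U \<omega> = u) = r m u"
  using cond_indep_prob[OF independences(1), of True m True True "(c, u)"] assms e_pos[of True]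
    prob_A_C_U[of True u]
  by (simp add: r_def cond_prob_def[of _ _ "\<lambda>\<omega>. A \<omega> \<and> _ \<omega>"])

text \<open>
  Consistency replaces \<open>Y\<close> by \<open>Y\<^sub>1\<^sub>m\<close> on \<open>A = 1, M = m\<close>. The independence of \<open>Y\<^sub>1\<^sub>m\<close> and \<open>M\<close> then
  removes the mediator from the condition and that of \<open>Y\<^sub>1\<^sub>m\<close> and \<open>A\<close> removes the exposure.
\<close>

lemma prob_Y_M_A_C_U:
  "pr (\<lambda>\<omega>. Y \<omega> \<and> M \<omega> = m \<and> A \<omega> \<and> C \<omega> = c \<and> U \<omega> = u) = e True * (r m u * (q True m u * w u))"
proof -
  have "pr (\<lambda>\<omega>. Y \<omega> \<and> M \<omega> = m \<and> A \<omega> \<and> C \<omega> = c \<and> U \<omega> = u) =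
      pr (\<lambda>\<omega>. outcome_am D True m \<omega> \<and> M \<omega> = m \<and> A \<omega> \<and> C \<omega> = c \<and> U \<omega> = u)"
    using consistent(2)[of _ True m] by (intro arg_cong[where f = "measure (law D)"]) auto
  also have "\<dots> = \<P>(\<omega> in law D. outcome_am D True m \<omega> \<bar> A \<omega> \<and> C \<omega> = c \<and> U \<omega> = u) *
      (e True * (q True m u * w u))"
    using cond_indep_prob[OF independences(2), of True m True m "(True, c, u)"]
      prob_M_A_C_U[of m True u] by simp
  also have "\<dots> = r m u * (e True * (q True m u * w u))"
    using cond_prob_outcome_am[of u m] w_nonneg[of u] by (cases "w u = 0") auto
  finally show ?thesis by simp
qed

text \<open>
  Both branches in the definition of the risk have the same value, so the levels of \<open>u\<close> that are
  impossible among the exposed in stratum \<open>m\<close> need no separate treatment.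
\<close>

lemma outcome_risk_eq:
  assumes "w u > 0"
  shows "outcome_risk D m c u = r m u"
proof -
  have "pr (\<lambda>\<omega>. A \<omega> \<and> M \<omega> = m \<and> C \<omega> = c \<and> U \<omega> = u) = e True * (q True m u * w u)"
    using prob_M_A_C_U[of m True u] by (simp add: conj_left_commute)
  moreover have "pr (\<lambda>\<omega>. Y \<omega> \<and> A \<omega> \<and> M \<omega> = m \<and> C \<omega> = c \<and> U \<omega> = u) =
      e True * (r m u * (q True m u * w u))"
    using prob_Y_M_A_C_U[of m u] by (simp add: conj_left_commute)
  ultimately show ?thesis
    unfolding outcome_risk_def by (auto simp: cond_prob_def r_def)
qed

text \<open>
  \<open>W a m\<close> is \<open>P(M\<^sub>a=m, c)\<close>, a mixture over \<open>u\<close> with weights \<open>P(c,u)\<close> that do not depend on \<open>a\<close>.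
  This is where \<open>A \<bottom> U | C\<close> enters: \<open>W a m\<close> is proportional to \<open>P(m | A=a,c)\<close>.
\<close>

definition W where "W a m = (\<Sum>u\<in>UNIV. q a m u * w u)"
definition K where "K = pr (\<lambda>\<omega>. C \<omega> = c)"

lemma W_nonneg: "W a m \<ge> 0"
  unfolding W_def by (intro sum_nonneg mult_nonneg_nonneg q_nonneg w_nonneg)

lemma K_pos: "K > 0"
  using assumptions by (simp add: mediation_assumptions_def positivity_def K_def)

lemma prob_A_C: "pr (\<lambda>\<omega>. A \<omega> = a \<and> C \<omega> = c) = e a * K"
  using K_pos by (simp add: e_def K_def cond_prob_def)

lemma prob_M_A_C: "pr (\<lambda>\<omega>. M \<omega> = m \<and> A \<omega> = a \<and> C \<omega> = c) = e a * W a m"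
  by (subst prob_total[of U])
    (simp_all add: conj_assoc prob_M_A_C_U W_def sum_distrib_left)

lemma cond_prob_M: "\<P>(\<omega> in law D. M \<omega> = m \<bar> A \<omega> = a \<and> C \<omega> = c) = W a m / K"
  using e_pos[of a] by (simp add: cond_prob_def prob_M_A_C prob_A_C)

lemma cond_prob_Y:
  "\<P>(\<omega> in law D. Y \<omega> \<bar> A \<omega> \<and> M \<omega> = m \<and> C \<omega> = c) =
    (\<Sum>u\<in>UNIV. r m u * (q True m u * w u)) / W True m"
proof -
  have "pr (\<lambda>\<omega>. Y \<omega> \<and> M \<omega> = m \<and> A \<omega> \<and> C \<omega> = c) =
      e True * (\<Sum>u\<in>UNIV. r m u * (q True m u * w u))"
    by (subst prob_total[of U]) (simp_all add: conj_assoc prob_Y_M_A_C_U sum_distrib_left)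
  then show ?thesis
    using e_pos[of True] prob_M_A_C[of m True]
    by (simp add: cond_prob_def conj_left_commute)
qed

lemma confounder_prob_eq: "confounder_prob D a m c u = q a m u * w u / W a m"
proof -
  have "pr (\<lambda>\<omega>. U \<omega> = u \<and> A \<omega> = a \<and> M \<omega> = m \<and> C \<omega> = c) = e a * (q a m u * w u)"
    using prob_M_A_C_U[of m a u] by (simp add: conj_ac)
  moreover have "pr (\<lambda>\<omega>. A \<omega> = a \<and> M \<omega> = m \<and> C \<omega> = c) = e a * W a m"
    using prob_M_A_C[of m a] by (simp add: conj_left_commute)
  ultimately show ?thesis
    using e_pos[of a] by (simp add: confounder_prob_def cond_prob_def)
qed

text \<open>
  The joint probability \<open>P(Y\<^sub>1\<^sub>M\<^sub>b=1, c)\<close> of the nested outcome, by the cross-world independence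
  of \<open>Y\<^sub>1\<^sub>m\<close> and \<open>M\<^sub>b\<close>.
\<close>

definition N where "N b = (\<Sum>m\<in>UNIV. \<Sum>u\<in>UNIV. r m u * (q b m u * w u))"

lemma prob_nested: "\<P>(\<omega> in law D. nested_outcome D True b \<omega> \<bar> C \<omega> = c) = N b / K"
proof -
  have "pr (\<lambda>\<omega>. nested_outcome D True b \<omega> \<and> C \<omega> = c) =
      pr (\<lambda>\<omega>. (\<exists>m. mediator_a D b \<omega> = m \<and> outcome_am D True m \<omega>) \<and> C \<omega> = c)"
    by (simp add: nested_outcome_def)
  also have "\<dots> = (\<Sum>m\<in>UNIV. pr (\<lambda>\<omega>. outcome_am D True m \<omega> \<and> mediator_a D b \<omega> = m \<and> C \<omega> = c))"
    by (subst prob_total[of "mediator_a D b"])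
      (auto intro!: sum.cong arg_cong[where f = "measure (law D)"])
  also have "\<dots> = N b"
    unfolding N_def
  proof (intro sum.cong refl)
    fix m
    show "pr (\<lambda>\<omega>. outcome_am D True m \<omega> \<and> mediator_a D b \<omega> = m \<and> C \<omega> = c) =
        (\<Sum>u\<in>UNIV. r m u * (q b m u * w u))"
      by (subst prob_total[of U]) (simp_all add: conj_assoc prob_outcome_am_mediator_a)
  qed
  finally show ?thesis by (simp add: cond_prob_def K_def)
qed

lemma NIE_true_eq: "NIE_true D c = N True / N False"
  using K_pos by (simp add: NIE_true_def prob_nested)

text \<open>
  The means that the bound compares: the outcome risk in stratum \<open>m\<close> averaged over the confounder
  law of the exposed (\<open>b = True\<close>) or of the unexposed (\<open>b = False\<close>).
\<close>

definition stratum_mean where "stratum_mean b m = (\<Sum>u\<in>UNIV. r m u * confounder_prob D b m c u)"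

lemma stratum_mean_mult_W: "stratum_mean b m * W b m = (\<Sum>u\<in>UNIV. r m u * (q b m u * w u))"
proof (cases "W b m = 0")
  case True
  then have "q b m u * w u = 0" for u
    unfolding W_def by (subst (asm) sum_nonneg_eq_0_iff) (auto simp: q_nonneg w_nonneg)
  then show ?thesis using True by (simp only: mult_zero_right sum.neutral_const)
qed (simp add: stratum_mean_def confounder_prob_eq flip: sum_divide_distrib)

lemma N_eq: "N b = (\<Sum>m\<in>UNIV. stratum_mean b m * W b m)"
  by (simp add: N_def stratum_mean_mult_W)

text \<open>
  Among the exposed, the observed risk in stratum \<open>m\<close> is the mean of \<open>r m\<close> under the confounder
  law of the exposed, whichever exposure level supplies the mediator weights. For \<open>a = True\<close> this
  is the nested outcome probability itself; for \<open>a = False\<close> it is biased in general.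
\<close>

lemma standardized_risk_eq: "standardized_risk D a c = (\<Sum>m\<in>UNIV. stratum_mean True m * W a m) / K"
  unfolding standardized_risk_def cond_prob_Y cond_prob_M
  by (simp add: stratum_mean_def confounder_prob_eq sum_divide_distrib)

lemma mediator_levels_eq: "mediator_levels D c = {m. W False m > 0}"
  using cond_prob_M[of _ False] K_pos by (simp add: mediator_levels_def zero_less_divide_iff)

lemma confounder_levels_eq: "confounder_levels D c = {u. w u > 0}"
  using K_pos
  by (simp add: confounder_levels_def cond_prob_def w_def K_def zero_less_divide_iff conj_commute)

lemma W_True_pos:
  assumes "W False m > 0"
  shows "W True m > 0"
proof -
  have "\<P>(\<omega> in law D. M \<omega> = m \<bar> \<not> A \<omega> \<and> C \<omega> = c) > 0 \<longrightarrow>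
      \<P>(\<omega> in law D. M \<omega> = m \<bar> A \<omega> \<and> C \<omega> = c) > 0"
    using assumptions unfolding mediation_assumptions_def positivity_def by blast
  then show ?thesis
    using assms cond_prob_M[of m False] cond_prob_M[of m True] K_pos
    by (simp add: zero_less_divide_iff)
qed

lemma N_pos: "N False > 0"
  using assumptions K_pos
  by (simp add: mediation_assumptions_def positivity_def prob_nested zero_less_divide_iff)

lemma standardized_risk_pos: "standardized_risk D False c > 0"
  using assumptions by (simp add: mediation_assumptions_def positivity_def)

lemma N_nonneg: "N b \<ge> 0"
  unfolding N_def by (intro sum_nonneg mult_nonneg_nonneg q_nonneg w_nonneg r_nonneg)

lemma mediator_levels_nonempty: "mediator_levels D c \<noteq> {}"
proof
  assume "mediator_levels D c = {}"
  then have "W False m = 0" for m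
    using W_nonneg[of False m] by (auto simp: mediator_levels_eq not_less intro: antisym)
  then show False using N_pos by (simp add: N_eq)
qed

section \<open>The bound\<close>

lemma confounder_prob_nonneg: "confounder_prob D a m c u \<ge> 0"
  by (simp add: confounder_prob_def cond_prob_def)

lemma sum_confounder_levels:
  "(\<Sum>u\<in>confounder_levels D c. f u * confounder_prob D a m c u) =
    (\<Sum>u\<in>UNIV. f u * confounder_prob D a m c u)"
  using w_nonneg
  by (intro sum.mono_neutral_left)
    (auto simp: confounder_levels_eq confounder_prob_eq not_less intro: antisym)

lemma sum_confounder_prob:
  assumes "W a m > 0"
  shows "(\<Sum>u\<in>confounder_levels D c. confounder_prob D a m c u) = 1"
  using sum_confounder_levels[of "\<lambda>_. 1" a m] assms
  by (simp add: confounder_prob_eq W_def flip: sum_divide_distrib)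

lemma ratio_le_RR_AU:
  assumes "m \<in> mediator_levels D c" "u \<in> confounder_levels D c"
    and "\<not> (confounder_prob D True m c u = 0 \<and> confounder_prob D False m c u = 0)"
  shows "ereal (confounder_prob D True m c u) / ereal (confounder_prob D False m c u) \<le> RR_AU D c"
  unfolding RR_AU_def
  by (rule Max_ge_iff[THEN iffD2], simp, use assms(1) in blast,
      rule bexI[OF _ imageI[OF assms(1)]], rule Max_ge) (use assms(2,3) in auto)

lemma confounder_prob_le_RR_AU:
  assumes "m \<in> mediator_levels D c" "u \<in> confounder_levels D c" "RR_AU D c = ereal g"
  shows "confounder_prob D True m c u \<le> g * confounder_prob D False m c u"
proof (cases "confounder_prob D True m c u = 0 \<and> confounder_prob D False m c u = 0")
  case False
  from ratio_le_RR_AU[OF assms(1,2) False] show ?thesis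
    using confounder_prob_nonneg[of True m u] confounder_prob_nonneg[of False m u] False assms(3)
    by (cases "confounder_prob D False m c u = 0") (auto simp: field_simps)
qed auto

text \<open>
  Two probability vectors cannot satisfy \<open>f1 \<le> g * f0\<close> with \<open>g < 1\<close>, as summation shows. A level
  that is possible among the exposed excludes the value \<open>-\<infinity>\<close>.
\<close>

lemma RR_AU_ge_1: "1 \<le> RR_AU D c"
proof -
  obtain m where m: "m \<in> mediator_levels D c"
    using mediator_levels_nonempty by blast
  then have W: "W False m > 0" "W True m > 0"
    using W_True_pos by (simp_all add: mediator_levels_eq)
  have "\<exists>u\<in>confounder_levels D c. confounder_prob D True m c u \<noteq> 0"
    using sum_confounder_prob[OF W(2)] by (metis sum.neutral zero_neq_one)
  then obtain u where "u \<in> confounder_levels D c" "confounder_prob D True m c u \<noteq> 0"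
    by blast
  then have "ereal (confounder_prob D True m c u) / ereal (confounder_prob D False m c u) \<le> RR_AU D c"
    using m by (intro ratio_le_RR_AU) auto
  moreover have "0 \<le> ereal (confounder_prob D True m c u) / ereal (confounder_prob D False m c u)"
    using confounder_prob_nonneg[of True m u] confounder_prob_nonneg[of False m u]
      \<open>confounder_prob D True m c u \<noteq> 0\<close> by (cases "confounder_prob D False m c u = 0") auto
  ultimately have "0 \<le> RR_AU D c" by (rule order_trans[rotated])
  then show ?thesis
  proof (cases "RR_AU D c")
    case (real g)
    have "1 = (\<Sum>u\<in>confounder_levels D c. confounder_prob D True m c u)"
      using sum_confounder_prob[OF W(2)] by simp
    also have "\<dots> \<le> (\<Sum>u\<in>confounder_levels D c. g * confounder_prob D False m c u)"
      using confounder_prob_le_RR_AU[OF m _ real] by (intro sum_mono)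
    also have "\<dots> = g"
      using sum_confounder_prob[OF W(1)] by (simp flip: sum_distrib_left)
    finally show ?thesis using real by (simp add: one_ereal_def)
  qed auto
qed

definition hi where "hi m = Max (outcome_risk D m c ` confounder_levels D c)"
definition lo where "lo m = Min (outcome_risk D m c ` confounder_levels D c)"

lemma r_le_hi: "u \<in> confounder_levels D c \<Longrightarrow> r m u \<le> hi m"
  and lo_le_r: "u \<in> confounder_levels D c \<Longrightarrow> lo m \<le> r m u"
  unfolding hi_def lo_def
  by (auto simp: outcome_risk_eq confounder_levels_eq intro!: Max_ge Min_le image_eqI)

lemma confounder_levels_nonempty: "confounder_levels D c \<noteq> {}"
  using mediator_levels_nonempty sum_confounder_prob[of False]
  by (force simp: mediator_levels_eq)

lemma lo_nonneg: "0 \<le> lo m"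
  using confounder_levels_nonempty r_nonneg
  by (auto simp: lo_def confounder_levels_eq outcome_risk_eq)

lemma lo_le_hi: "lo m \<le> hi m"
  using confounder_levels_nonempty r_le_hi lo_le_r by (meson all_not_in_conv order_trans)

lemma ratio_le_RR_UY:
  assumes "m \<in> mediator_levels D c"
  shows "(if hi m = 0 \<and> lo m = 0 then 1 else ereal (hi m) / ereal (lo m)) \<le> RR_UY D c"
  unfolding RR_UY_def Let_def hi_def[symmetric] lo_def[symmetric]
  using assms by (intro Max_ge imageI) auto

lemma RR_UY_ge_1: "1 \<le> RR_UY D c"
proof -
  obtain m where m: "m \<in> mediator_levels D c"
    using mediator_levels_nonempty by blast
  have "1 \<le> (if hi m = 0 \<and> lo m = 0 then 1 else ereal (hi m) / ereal (lo m))"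
    using lo_le_hi[of m] lo_nonneg[of m]
    by (cases "lo m = 0") (auto simp: one_ereal_def field_simps)
  with ratio_le_RR_UY[OF m] show ?thesis by order
qed

lemma hi_le_RR_UY:
  assumes "m \<in> mediator_levels D c" "RR_UY D c = ereal d"
  shows "hi m \<le> d * lo m"
  using ratio_le_RR_UY[OF assms(1)] assms(2) lo_le_hi[of m] lo_nonneg[of m]
  by (cases "lo m = 0") (auto simp: field_simps split: if_splits)

lemma stratum_mean_le:
  assumes m: "m \<in> mediator_levels D c" and b: "BF D c = ereal b"
  shows "stratum_mean True m \<le> b * stratum_mean False m"
proof -
  have W: "W False m > 0" "W True m > 0"
    using m W_True_pos by (simp_all add: mediator_levels_eq)
  show ?thesis
    unfolding stratum_mean_def sum_confounder_levels[symmetric]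
    using sum_confounder_prob[OF W(2)] confounder_prob_nonneg
      sum_confounder_prob[OF W(1)] confounder_prob_nonneg r_nonneg lo_le_r r_le_hi
      RR_AU_ge_1 confounder_prob_le_RR_AU[OF m] RR_UY_ge_1 hi_le_RR_UY[OF m] b[unfolded BF_def]
    by (rule mean_le_bounding_factor)
qed

lemma standardized_risk_le:
  assumes b: "BF D c = ereal b"
  shows "standardized_risk D False c * K \<le> b * N False"
proof -
  have "standardized_risk D False c * K = (\<Sum>m\<in>UNIV. stratum_mean True m * W False m)"
    using K_pos by (simp add: standardized_risk_eq)
  also have "\<dots> \<le> (\<Sum>m\<in>UNIV. (b * stratum_mean False m) * W False m)"
  proof (rule sum_mono)
    fix m
    show "stratum_mean True m * W False m \<le> (b * stratum_mean False m) * W False m"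
      using stratum_mean_le[OF _ b, of m] W_nonneg[of False m]
      by (cases "W False m = 0") (auto simp: mediator_levels_eq intro: mult_right_mono)
  qed
  also have "\<dots> = b * N False"
    by (simp add: N_eq sum_distrib_left mult.assoc)
  finally show ?thesis .
qed

lemma NIE_obs_eq: "NIE_obs D c = N True / (standardized_risk D False c * K)"
  by (simp add: NIE_obs_def standardized_risk_eq[of True] N_eq)

text \<open>
  The numerators of both effects equal \<open>N True\<close> up to the factor \<open>K\<close>, so the bound is the
  comparison of denominators in \<open>standardized_risk_le\<close>. If the bounding factor is \<open>\<infinity>\<close> there is
  still something to check, because \<open>0 * \<infinity> = 0\<close>: a vanishing observed effect comes with
  \<open>N True = 0\<close>, hence with a vanishing true effect.
\<close>

theorem NIE_true_le: "ereal (NIE_true D c) \<le> ereal (NIE_obs D c) * BF D c"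
proof (cases "BF D c")
  case (real b)
  have pos: "standardized_risk D False c * K > 0"
    using standardized_risk_pos K_pos by simp
  have "N True / N False = N True * (standardized_risk D False c * K) /
      (N False * (standardized_risk D False c * K))"
    using pos by (intro mult_divide_mult_cancel_right[symmetric]) (rule less_imp_neq[symmetric])
  also have "\<dots> \<le> N True * (b * N False) / (N False * (standardized_risk D False c * K))"
    using standardized_risk_le[OF real] N_nonneg[of True] N_pos pos
    by (intro divide_right_mono mult_left_mono) auto
  also have "\<dots> = NIE_obs D c * b"
    using N_pos by (simp add: NIE_obs_eq)
  finally show ?thesis
    using real by (simp add: NIE_true_eq)
next
  case PInf
  show ?thesis
    using PInf N_nonneg[of True] K_pos standardized_risk_pos
    by (cases "N True = 0") (auto simp: NIE_true_eq NIE_obs_eq)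
next
  case MInf
  show ?thesis
    using RR_AU_ge_1 RR_UY_ge_1 MInf unfolding BF_def
    by (cases rule: bounding_factor_cases) (auto simp: bounding_factor_def)
qed

end

section \<open>A family attaining the bound\<close>

text \<open>
  Three independent bits \<open>A, U, V\<close>, coded as one natural number, with \<open>P(A=1) = 1/2\<close>,
  \<open>P(U=1) = p\<close> and \<open>P(V=1) = s\<close>.
\<close>

definition extremal_law :: "real \<Rightarrow> real \<Rightarrow> nat pmf" where
  "extremal_law p s = map_pmf (to_nat :: bool \<times> bool \<times> bool \<Rightarrow> nat) (pair_pmf (bernoulli_pmf (1/2)) (pair_pmf (bernoulli_pmf p) (bernoulli_pmf s)))"

abbreviation bit_A where "bit_A n \<equiv> fst (from_nat n :: bool \<times> bool \<times> bool)"
abbreviation bit_U where "bit_U n \<equiv> fst (snd (from_nat n :: bool \<times> bool \<times> bool))"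
abbreviation bit_V where "bit_V n \<equiv> snd (snd (from_nat n :: bool \<times> bool \<times> bool))"

text \<open>
  The outcome \<open>U \<or> V\<close> has risk \<open>1\<close> if \<open>U = 1\<close> and \<open>s\<close> if \<open>U = 0\<close>. It ignores exposure and
  mediator, so the true effect is \<open>1\<close>. Every potential mediator is a function of \<open>U\<close>, and \<open>A\<close> is
  independent of \<open>(U, V)\<close>, so all required independences hold. Without exposure the mediator is
  \<open>1\<close>; with exposure it equals \<open>U\<close>, so that the stratum \<open>M = 1\<close> of the exposed only contains
  \<open>U = 1\<close>, against a proportion \<open>p\<close> among the unexposed. The flag \<open>k\<close> makes the mediator
  constant: the value \<open>1\<close> of \<open>RR\<^sub>A\<^sub>U\<close> would need \<open>p = 1\<close> otherwise, and then \<open>U\<close> would be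
  degenerate and force \<open>RR\<^sub>U\<^sub>Y = 1\<close>.
\<close>

definition extremal_data :: "'c \<Rightarrow> bool \<Rightarrow> real \<Rightarrow> real \<Rightarrow> (nat, bool, 'c, bool) mediation_data" where
  "extremal_data c k p s =
    \<lparr> law = measure_pmf (extremal_law p s),
      exposure = (\<lambda>\<omega>. bit_A \<omega>),
      outcome = (\<lambda>\<omega>. bit_U \<omega> \<or> bit_V \<omega>),
      mediator = (\<lambda>\<omega>. bit_A \<omega> \<longrightarrow> bit_U \<omega> \<or> k),
      covariate = (\<lambda>_. c),
      confounder = (\<lambda>\<omega>. bit_U \<omega>),
      outcome_a = (\<lambda>a \<omega>. bit_U \<omega> \<or> bit_V \<omega>),
      mediator_a = (\<lambda>a \<omega>. a \<longrightarrow> bit_U \<omega> \<or> k),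
      outcome_am = (\<lambda>a m \<omega>. bit_U \<omega> \<or> bit_V \<omega>) \<rparr>"

text \<open>
  Every probability in the extremal model is a sum over the eight values of the bits. Evaluating
  these sums proves the assumptions and computes the effects and the sensitivity parameters.
\<close>

lemma prob_extremal:
  assumes "0 \<le> p" "p \<le> 1" "0 \<le> s" "s \<le> 1"
  shows "measure_pmf.prob (extremal_law p s) {\<omega>. Q \<omega>} =
    (\<Sum>a::bool\<in>UNIV. \<Sum>u\<in>UNIV. \<Sum>v\<in>UNIV. if Q (to_nat (a, u, v))
       then 1/2 * (if u then p else 1 - p) * (if v then s else 1 - s) else 0)"
proof -
  define bits where "bits = pair_pmf (bernoulli_pmf (1/2)) (pair_pmf (bernoulli_pmf p) (bernoulli_pmf s))"
  have "measure_pmf.prob (extremal_law p s) {\<omega>. Q \<omega>} = measure (measure_pmf bits) {x. Q (to_nat x)}"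
    by (simp add: extremal_law_def bits_def vimage_def)
  also have "\<dots> = sum (pmf bits) {x. Q (to_nat x)}"
    by (rule measure_measure_pmf_finite) simp
  also have "\<dots> = (\<Sum>x\<in>UNIV. if Q (to_nat x) then pmf bits x else 0)"
    by (simp add: sum.If_cases)
  also have "\<dots> = (\<Sum>(a::bool, u, v)\<in>UNIV \<times> UNIV \<times> UNIV. if Q (to_nat (a, u, v))
       then 1/2 * (if u then p else 1 - p) * (if v then s else 1 - s) else 0)"
    unfolding UNIV_Times_UNIV using assms by (intro sum.cong) (auto simp: bits_def pmf_pair)
  finally show ?thesis
    by (simp only: sum.cartesian_product)
qed

lemma extremal_weights_sum:
  fixes p s x :: real
  shows "x * (1 - s) + x * s = x" "x * (1 - s) / 2 + x * s / 2 = x / 2" "(1 - p) / 2 + p / 2 = 1 / 2"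
  by (simp_all add: field_simps)

lemma extremal_weights_pos:
  fixes p s :: real
  assumes "0 < p" "p < 1" "0 < s"
  shows "(1 - p) * s + p > 0" "(1 - p) * s / 2 + p / 2 > 0"
  using assms by (intro add_pos_pos; simp)+

lemma extremal_assumptions:
  assumes "0 < p" "p < 1" "0 < s" "s \<le> 1"
  shows "mediation_assumptions (extremal_data (c::'c::finite) k p s) c"
proof -
  let ?D = "extremal_data c k p s"
  note pos = extremal_weights_pos[OF assms(1-3)]
  note pr = prob_extremal[OF assms(1-3)[THEN less_imp_le] assms(4)] extremal_weights_sum
  have "mediation_model ?D"
    unfolding mediation_model_def random_variables_def consistency_def composition_def
      nested_outcome_def extremal_data_def
    by (simp add: measure_pmf.prob_space_axioms)
  moreover have "positivity ?D c"
    using assms pos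
    unfolding positivity_def standardized_risk_def nested_outcome_def extremal_data_def
    by (auto simp: pr cond_prob_def all_bool_eq UNIV_bool)
  moreover have "no_confounding_given_CU ?D"
    using assms unfolding no_confounding_given_CU_def cond_indep_def extremal_data_def
    by (auto simp: pr cond_prob_def all_bool_eq UNIV_bool)
  moreover have "cond_indep (law ?D) (exposure ?D) (confounder ?D) (covariate ?D)"
    using assms unfolding cond_indep_def extremal_data_def
    by (auto simp: pr cond_prob_def all_bool_eq UNIV_bool)
  ultimately show ?thesis
    by (simp add: mediation_assumptions_def)
qed

lemma extremal_values:
  fixes c :: "'c::finite" and k :: bool
  assumes "0 < p" "p < 1" "0 < s" "s \<le> 1"
  defines "D \<equiv> extremal_data c k p s"
  shows "NIE_true D c = 1"
    and "NIE_obs D c = (if k then 1 else p + (1 - p) * s)"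
    and "RR_AU D c = ereal (if k then 1 else 1 / p)"
    and "RR_UY D c = ereal (1 / s)"
proof -
  note pos = extremal_weights_pos[OF assms(1-3)]
  note pr = prob_extremal[OF assms(1-3)[THEN less_imp_le] assms(4)] extremal_weights_sum
  note defs = D_def extremal_data_def cond_prob_def
  show "NIE_true D c = 1"
    using assms pos unfolding NIE_true_def nested_outcome_def defs
    by (simp add: pr UNIV_bool)
  show "NIE_obs D c = (if k then 1 else p + (1 - p) * s)"
  proof -
    have "standardized_risk D True c = p + (1 - p) * s"
      using assms(1-4) pos unfolding standardized_risk_def defs
      by (cases k) (simp_all add: pr UNIV_bool)
    moreover have "standardized_risk D False c = (if k then p + (1 - p) * s else 1)"
      using assms(1-4) pos unfolding standardized_risk_def defs
      by (cases k) (simp_all add: pr UNIV_bool)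
    ultimately show ?thesis
      using pos(1) by (simp add: NIE_obs_def)
  qed
  have m: "mediator_levels D c = {True}"
  proof -
    have "m \<in> mediator_levels D c \<longleftrightarrow> m" for m
      using assms(1-4) unfolding mediator_levels_def defs
      by (cases m) (simp_all add: pr UNIV_bool)
    then show ?thesis by auto
  qed
  have u: "confounder_levels D c = {True, False}"
  proof -
    have "u \<in> confounder_levels D c" for u
      using assms(1-4) unfolding confounder_levels_def defs
      by (cases u) (simp_all add: pr UNIV_bool)
    then show ?thesis by auto
  qed
  have risk: "outcome_risk D True c u = (if u then 1 else s)" for u
    using assms(1-4) unfolding outcome_risk_def defs
    by (cases u; cases k; simp add: pr UNIV_bool; simp add: field_simps)
  have confounder: "confounder_prob D True True c u =
      (if k then if u then p else 1 - p else if u then 1 else 0)"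
    "confounder_prob D False True c u = (if u then p else 1 - p)" for u
    using assms(1-4) unfolding confounder_prob_def defs
    by (cases u; cases k; simp add: pr UNIV_bool)+
  show "RR_UY D c = ereal (1 / s)"
    using assms(1-4) by (simp add: RR_UY_def m u risk Let_def)
  have "{u \<in> {True, False}. \<not> (confounder_prob D True True c u = 0 \<and>
      confounder_prob D False True c u = 0)} = {True, False}"
    using assms(1,2) by (auto simp: confounder)
  then show "RR_AU D c = ereal (if k then 1 else 1 / p)"
    using assms(1,2) unfolding RR_AU_def m u by (simp add: confounder one_ereal_def max_def)
qed

text \<open>
  For \<open>\<gamma> > 1\<close>, \<open>p = 1/\<gamma>\<close> and \<open>s = 1/\<delta>\<close> the observed effect is
  \<open>p + (1 - p) * s = (\<gamma> + \<delta> - 1) / (\<gamma> * \<delta>)\<close>, the inverse of the bounding factor. For \<open>\<gamma> = 1\<close> the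
  bounding factor and the observed effect are both \<open>1\<close>.
\<close>

lemma bound_attained:
  fixes c :: "'c::finite" and \<gamma> \<delta> :: real
  assumes "1 \<le> \<gamma>" "1 \<le> \<delta>"
  obtains D :: "(nat, bool, 'c, bool) mediation_data" where
      "mediation_assumptions D c" "RR_AU D c = ereal \<gamma>" "RR_UY D c = ereal \<delta>"
      "ereal (NIE_true D c) = ereal (NIE_obs D c) * BF D c"
proof
  define k where "k \<longleftrightarrow> \<gamma> = 1"
  \<comment> \<open>If \<open>k\<close> holds, any \<open>p\<close> strictly between \<open>0\<close> and \<open>1\<close> would do.\<close>
  define p where "p = (if k then 1 / 2 else 1 / \<gamma>)"
  define D where "D = extremal_data c k p (1 / \<delta>)"
  have p: "0 < p" "p < 1" and s: "0 < 1 / \<delta>" "1 / \<delta> \<le> 1"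
    using assms by (auto simp: p_def k_def)
  note extremal = extremal_values[OF p s, of c k, folded D_def]
  show "mediation_assumptions D c"
    unfolding D_def by (rule extremal_assumptions[OF p s])
  show RR: "RR_AU D c = ereal \<gamma>" "RR_UY D c = ereal \<delta>"
    using extremal(3,4) by (auto simp: p_def k_def)
  have "NIE_obs D c * (\<gamma> * \<delta> / (\<gamma> + \<delta> - 1)) = 1"
    using assms extremal(2) by (auto simp: p_def k_def field_simps)
  moreover have "BF D c = ereal (\<gamma> * \<delta> / (\<gamma> + \<delta> - 1))"
    using assms unfolding BF_def RR
    by (simp add: bounding_factor_def one_ereal_def)
  ultimately have "ereal (NIE_obs D c) * BF D c = ereal 1"
    by (simp only: times_ereal.simps(1))
  then show "ereal (NIE_true D c) = ereal (NIE_obs D c) * BF D c"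
    using extremal(1) by simp
qed

theorem theorem2:
  fixes c :: "'c::finite"
  shows "(\<forall>D :: ('w, 'm::finite, 'c, 'u::finite) mediation_data.
            mediation_assumptions D c \<longrightarrow> ereal (NIE_true D c) \<le> ereal (NIE_obs D c) * BF D c) \<and>
         (\<forall>\<gamma> \<delta> :: real. \<gamma> \<ge> 1 \<and> \<delta> \<ge> 1 \<longrightarrow>
            (\<exists>D :: (nat, bool, 'c, bool) mediation_data.
               mediation_assumptions D c \<and> RR_AU D c = ereal \<gamma> \<and> RR_UY D c = ereal \<delta> \<and>
               ereal (NIE_true D c) = ereal (NIE_obs D c) * BF D c))"
  using mediation.NIE_true_le[OF mediation.intro] bound_attained by metis

end
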